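(* Let $A_1=P_1-R_1+S_1$ be a convergent double weak splitting of type II of the nonsingular symmetric matrix $A_1\in\mathbb{R}^{n\times n}$ and let $A_2=P_2-R_2+S_2$ be a convergent double weak splitting of type I of the nonsingular symmetric matrix $A_2\in\mathbb{R}^{n\times n}$. Put $$\widetilde{\mathbf{W}}_1=\begin{pmatrix}(R_1P_1^{-1})^T & -(S_1P_1^{-1})^T\\ I & 0\end{pmatrix},\qquad \widehat{\mathbf{W}}_2=\begin{pmatrix}P_2^{-1}R_2 & -P_2^{-1}S_2\\ I & 0\end{pmatrix}.$$ If $P_2^{-1}R_2\le(R_1P_1^{-1})^T$ and $P_2^{-1}A_2\le(P_1^{-1})^TA_1$, then $\rho(\widetilde{\mathbf{W}}_1)\le\rho(\widehat{\mathbf{W}}_2)<1$.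
   Context: Matrix inequalities are entrywise; $\rho$ is the spectral radius; $I$ is the $n\times n$ identity. For a nonsingular $A\in\mathbb{R}^{n\times n}$, a decomposition $A=P-R+S$ with $P$ nonsingular is a double weak splitting of type I if $P^{-1}R\ge 0$ and $-P^{-1}S\ge 0$; it is convergent if $\begin{pmatrix}P^{-1}R & -P^{-1}S\\ I & 0\end{pmatrix}$ has spectral radius less than $1$. For a symmetric nonsingular $A$, such a decomposition is a double weak splitting of type II if $RP^{-1}\ge 0$ and $-SP^{-1}\ge 0$; it is convergent if $\begin{pmatrix}(RP^{-1})^T & -(SP^{-1})^T\\ I & 0\end{pmatrix}$ has spectral radius less than $1$. *)

theory Defs
  imports
    "Jordan_Normal_Form.Gauss_Jordan_Elimination"
    "Jordan_Normal_Form.Spectral_Radius"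
begin

(* Only meaningful for a nonsingular P; see mat_inv_inverse below. *)
definition mat_inv :: "real mat \<Rightarrow> real mat" where
  "mat_inv P = the (mat_inverse P)"

lemma mat_inv_inverse:
  assumes P: "P \<in> carrier_mat n n" and inv: "invertible_mat P"
  shows "P * mat_inv P = 1\<^sub>m n" "mat_inv P * P = 1\<^sub>m n" "mat_inv P \<in> carrier_mat n n"
proof -
  obtain B where B: "P * B = 1\<^sub>m n" "B * P = 1\<^sub>m (dim_row B)"
    using inv P unfolding invertible_mat_def inverts_mat_def by auto
  have "dim_col B = n" using arg_cong[OF B(1), of dim_col] by simp
  moreover have "dim_row B = n" using arg_cong[OF B(2), of dim_col] P by simp
  ultimately have "B \<in> carrier_mat n n" by blast
  hence "P \<in> Units (ring_mat TYPE(real) n ())"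
    using P B unfolding Units_def ring_mat_def by auto
  then obtain C where C: "mat_inverse P = Some C"
    using mat_inverse(1)[OF P, of "()"] by (cases "mat_inverse P") auto
  from mat_inverse(2)[OF P C]
  show "P * mat_inv P = 1\<^sub>m n" "mat_inv P * P = 1\<^sub>m n" "mat_inv P \<in> carrier_mat n n"
    unfolding mat_inv_def C by auto
qed

(* The spectrum is taken over the complex numbers. *)
definition real_spectral_radius :: "real mat \<Rightarrow> real" where
  "real_spectral_radius M = spectral_radius (map_mat complex_of_real M)"

definition block_I :: "nat \<Rightarrow> real mat \<Rightarrow> real mat \<Rightarrow> real mat \<Rightarrow> real mat" where
  "block_I n P R S =
     four_block_mat (mat_inv P * R) (- (mat_inv P * S)) (1\<^sub>m n) (0\<^sub>m n n)"

definition block_II :: "nat \<Rightarrow> real mat \<Rightarrow> real mat \<Rightarrow> real mat \<Rightarrow> real mat" where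
  "block_II n P R S =
     four_block_mat (R * mat_inv P)\<^sup>T (- (S * mat_inv P)\<^sup>T) (1\<^sub>m n) (0\<^sub>m n n)"

definition splitting_base ::
    "nat \<Rightarrow> real mat \<Rightarrow> real mat \<Rightarrow> real mat \<Rightarrow> real mat \<Rightarrow> bool" where
  "splitting_base n A P R S \<longleftrightarrow>
     A \<in> carrier_mat n n \<and> P \<in> carrier_mat n n \<and> R \<in> carrier_mat n n \<and> S \<in> carrier_mat n n \<and>
     invertible_mat A \<and> invertible_mat P \<and> A = P - R + S"

(* The order on matrices is entrywise and includes equality of dimensions. *)
definition double_weak_splitting_I ::
    "nat \<Rightarrow> real mat \<Rightarrow> real mat \<Rightarrow> real mat \<Rightarrow> real mat \<Rightarrow> bool" where
  "double_weak_splitting_I n A P R S \<longleftrightarrow>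
     splitting_base n A P R S \<and>
     0\<^sub>m n n \<le> mat_inv P * R \<and> 0\<^sub>m n n \<le> - (mat_inv P * S)"

definition double_weak_splitting_II ::
    "nat \<Rightarrow> real mat \<Rightarrow> real mat \<Rightarrow> real mat \<Rightarrow> real mat \<Rightarrow> bool" where
  "double_weak_splitting_II n A P R S \<longleftrightarrow>
     splitting_base n A P R S \<and> A\<^sup>T = A \<and>
     0\<^sub>m n n \<le> R * mat_inv P \<and> 0\<^sub>m n n \<le> - (S * mat_inv P)"

definition convergent_double_weak_splitting_I ::
    "nat \<Rightarrow> real mat \<Rightarrow> real mat \<Rightarrow> real mat \<Rightarrow> real mat \<Rightarrow> bool" where
  "convergent_double_weak_splitting_I n A P R S \<longleftrightarrow>
     double_weak_splitting_I n A P R S \<and> real_spectral_radius (block_I n P R S) < 1"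

definition convergent_double_weak_splitting_II ::
    "nat \<Rightarrow> real mat \<Rightarrow> real mat \<Rightarrow> real mat \<Rightarrow> real mat \<Rightarrow> bool" where
  "convergent_double_weak_splitting_II n A P R S \<longleftrightarrow>
     double_weak_splitting_II n A P R S \<and> real_spectral_radius (block_II n P R S) < 1"

end

theory Submission
  imports Defs
begin

text \<open>
  Write \<open>B\<^sub>i\<close>, \<open>C\<^sub>i\<close> for the upper blocks of the two companion matrices. Symmetry of \<open>A1\<close> gives
  \<open>B\<^sub>1 + C\<^sub>1 = I - (P1\<^sup>-\<^sup>1)\<^sup>T A1 \<le> I - P2\<^sup>-\<^sup>1 A2 = B\<^sub>2 + C\<^sub>2\<close>, while \<open>B\<^sub>2 \<le> B\<^sub>1\<close>. If \<open>(y, u)\<close> is a complex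
  eigenvector of the first matrix for an eigenvalue of maximal modulus \<open>r < 1\<close>, then \<open>y = \<lambda> u\<close> and
  \<open>r\<^sup>2 |u| \<le> (r B\<^sub>1 + C\<^sub>1) |u| = (B\<^sub>1 + C\<^sub>1 - (1 - r) B\<^sub>1) |u| \<le> (r B\<^sub>2 + C\<^sub>2) |u|\<close>, so the nonnegative
  vector \<open>x = (r |u|, |u|)\<close> satisfies \<open>r x \<le> W\<^sub>2 x\<close>. A nonnegative matrix with such a nonzero
  subinvariant vector has spectral radius at least \<open>r\<close>, because its powers grow at least like \<open>r\<^sup>k\<close>.
  No Perron vector is needed.
\<close>

lemma index_mult_mat_vec_sum:
  assumes "A \<in> carrier_mat nr nc" "v \<in> carrier_vec nc" "i < nr"
  shows "(A *\<^sub>v v) $ i = (\<Sum>j<nc. A $$ (i, j) * v $ j)"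
  using assms by (auto simp: scalar_prod_def lessThan_atLeast0)

lemma zero_mat_mult_vec:
  assumes "v \<in> carrier_vec nc"
  shows "0\<^sub>m nr nc *\<^sub>v v = 0\<^sub>v nr"
  using assms by (intro eq_vecI) auto

lemma spectral_radius_nonneg:
  assumes "A \<in> carrier_mat n n" "n > 0"
  shows "0 \<le> spectral_radius A"
  using spectral_radius_mem_max(1)[OF assms] by auto

text \<open>An eigenvector of \<open>c \<cdot>\<^sub>m A\<close> for \<open>a\<close> is an
  eigenvector of \<open>A\<close> for \<open>a / c\<close>; applied to an eigenvalue
  \<open>a\<close> of maximal modulus. It serves to rescale a matrix to spectral radius below
  1.\<close>

lemma spectral_radius_smult_le:
  fixes A :: "complex mat"
  assumes A: "A \<in> carrier_mat n n" and n: "n > 0" and c: "c \<noteq> 0"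
  shows "spectral_radius (c \<cdot>\<^sub>m A) \<le> norm c * spectral_radius A"
proof -
  have cA: "c \<cdot>\<^sub>m A \<in> carrier_mat n n" using A by simp
  obtain a where a: "a \<in> spectrum (c \<cdot>\<^sub>m A)" and ra: "spectral_radius (c \<cdot>\<^sub>m A) = norm a"
    using spectral_radius_mem_max(1)[OF cA n] by auto
  obtain v where v: "v \<in> carrier_vec n" "v \<noteq> 0\<^sub>v n" "(c \<cdot>\<^sub>m A) *\<^sub>v v = a \<cdot>\<^sub>v v"
    using a A unfolding spectrum_def eigenvalue_def eigenvector_def by auto
  have "A *\<^sub>v v = (a / c) \<cdot>\<^sub>v v"
  proof (rule eq_vecI)
    fix i assume "i < dim_vec ((a / c) \<cdot>\<^sub>v v)"
    hence i: "i < n" using v by simp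
    have "c * (A *\<^sub>v v) $ i = a * v $ i"
      using arg_cong[OF v(3), of "\<lambda>w. w $ i"] i v(1) A by simp
    thus "(A *\<^sub>v v) $ i = ((a / c) \<cdot>\<^sub>v v) $ i" using i v c by (simp add: field_simps)
  qed (use A v in auto)
  hence "a / c \<in> spectrum A"
    using v A unfolding spectrum_def eigenvalue_def eigenvector_def by auto
  hence "norm (a / c) \<le> spectral_radius A" by (intro spectral_radius_mem_max(2)[OF A n]) auto
  thus ?thesis using c by (simp add: ra norm_divide field_simps)
qed

text \<open>Powers of a nonnegative matrix are nonnegative, so \<open>A ^\<^sub>m k\<close> may be
  applied to both sides of \<open>q x \<le> A x\<close>; induction on \<open>k\<close> then gains
  one factor \<open>q\<close> per step.\<close>

lemma pow_mat_nonneg_and_subinvariant: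
  fixes A :: "real mat"
  assumes A: "A \<in> carrier_mat n n" and A0: "\<And>i j. i < n \<Longrightarrow> j < n \<Longrightarrow> 0 \<le> A $$ (i, j)"
    and x: "x \<in> carrier_vec n" and q: "0 \<le> q"
    and sub: "\<And>i. i < n \<Longrightarrow> q * x $ i \<le> (A *\<^sub>v x) $ i"
  shows "i < n \<Longrightarrow> q ^ k * x $ i \<le> (A ^\<^sub>m k *\<^sub>v x) $ i"
    and "i < n \<Longrightarrow> j < n \<Longrightarrow> 0 \<le> (A ^\<^sub>m k) $$ (i, j)"
proof -
  have P: "A ^\<^sub>m k \<in> carrier_mat n n" for k using A by simp
  have nonneg: "\<forall>i<n. \<forall>j<n. 0 \<le> (A ^\<^sub>m k) $$ (i, j)" for k
  proof (induction k)
    case 0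
    show ?case using A by simp
  next
    case (Suc k)
    show ?case using A P[of k] Suc A0 by (auto simp: scalar_prod_def intro!: sum_nonneg mult_nonneg_nonneg)
  qed
  thus "i < n \<Longrightarrow> j < n \<Longrightarrow> 0 \<le> (A ^\<^sub>m k) $$ (i, j)" by simp
  have "\<forall>i<n. q ^ k * x $ i \<le> (A ^\<^sub>m k *\<^sub>v x) $ i"
  proof (induction k)
    case 0
    show ?case using A x by simp
  next
    case (Suc k)
    show ?case
    proof (intro allI impI)
      fix i assume i: "i < n"
      have "q ^ Suc k * x $ i \<le> q * (A ^\<^sub>m k *\<^sub>v x) $ i"
        using mult_left_mono[OF Suc[rule_format, OF i] q] by (simp add: mult.assoc)
      also have "\<dots> = (\<Sum>j<n. (A ^\<^sub>m k) $$ (i, j) * (q * x $ j))"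
        using index_mult_mat_vec_sum[OF P x i] by (simp add: sum_distrib_left mult.left_commute)
      also have "\<dots> \<le> (\<Sum>j<n. (A ^\<^sub>m k) $$ (i, j) * (A *\<^sub>v x) $ j)"
        using nonneg i sub by (intro sum_mono mult_left_mono) auto
      also have "\<dots> = (A ^\<^sub>m Suc k *\<^sub>v x) $ i"
        using index_mult_mat_vec_sum[OF P _ i, of "A *\<^sub>v x"] A x P
        by (simp add: assoc_mult_mat_vec[OF P A x])
      finally show "q ^ Suc k * x $ i \<le> (A ^\<^sub>m Suc k *\<^sub>v x) $ i" .
    qed
  qed
  thus "i < n \<Longrightarrow> q ^ k * x $ i \<le> (A ^\<^sub>m k *\<^sub>v x) $ i" by simp
qed

text \<open>If the spectral radius were below \<open>r\<close>, rescaling by a number strictly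
  between the two would give a matrix with bounded powers that nevertheless stretch \<open>x\<close>
  geometrically.\<close>

lemma real_spectral_radius_ge_subinvariant:
  assumes W: "W \<in> carrier_mat n n" and W0: "\<And>i j. i < n \<Longrightarrow> j < n \<Longrightarrow> 0 \<le> W $$ (i, j)"
    and x: "x \<in> carrier_vec n" and x0: "\<And>i. i < n \<Longrightarrow> 0 \<le> x $ i" and xne: "x \<noteq> 0\<^sub>v n"
    and sub: "\<And>i. i < n \<Longrightarrow> r * x $ i \<le> (W *\<^sub>v x) $ i"
  shows "r \<le> real_spectral_radius W"
proof (rule ccontr)
  let ?C = "map_mat complex_of_real"
  obtain i where i: "i < n" "x $ i \<noteq> 0"
    using xne x by (metis carrier_vecD eq_vecI index_zero_vec)
  hence xi: "0 < x $ i" and n: "n > 0" using x0[of i] by auto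
  have CW: "?C W \<in> carrier_mat n n" using W by simp
  assume "\<not> ?thesis"
  \<comment> \<open>The strict gap on both sides matters: \<open>W / s\<close> has spectral radius
    below 1, while the growth factor \<open>r / s\<close> exceeds 1.\<close>
  then obtain s where s: "real_spectral_radius W < s" "s < r"
    using dense[of "real_spectral_radius W" r] by (auto simp: not_le)
  have s0: "0 < s"
    using s spectral_radius_nonneg[OF CW n] unfolding real_spectral_radius_def by simp
  define V where "V = (1 / s) \<cdot>\<^sub>m W"
  have V: "V \<in> carrier_mat n n" using W unfolding V_def by simp
  have V0: "0 \<le> V $$ (i, j)" if "i < n" "j < n" for i j
    using that W W0 s0 by (simp add: V_def)
  have CV: "?C V = complex_of_real (1 / s) \<cdot>\<^sub>m ?C W"
    using W unfolding V_def by (intro eq_matI) auto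
  have "spectral_radius (?C V) \<le> real_spectral_radius W / s"
    using spectral_radius_smult_le[OF CW n, of "complex_of_real (1 / s)"] s0
    unfolding CV real_spectral_radius_def by (simp add: norm_divide)
  also have "\<dots> < 1" using s s0 by simp
  \<comment> \<open>Spectral radius below 1 bounds the entries of all powers by one constant
    \<open>c\<close>, independent of \<open>k\<close>; the Jordan normal form supplies it.\<close>
  finally obtain c where c: "\<And>k. norm_bound (?C V ^\<^sub>m k) c"
    using spectral_radius_jnf_norm_bound_less_1_upper_triangular[of "?C V" n] V by auto
  define q where "q = r / s"
  have q: "1 < q" using s s0 by (simp add: q_def)
  have subV: "q * x $ i \<le> (V *\<^sub>v x) $ i" if "i < n" for i
    using sub[OF that] that W x s0 by (simp add: V_def q_def field_simps)
  have "q ^ k * x $ i \<le> c * (\<Sum>j<n. x $ j)" for k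
  proof -
    \<comment> \<open>The bound concerns complex matrices; it descends to \<open>V\<close> because
      the embedding of the reals commutes with powers and preserves absolute values.\<close>
    have entry: "(V ^\<^sub>m k) $$ (i, j) \<le> c" if "j < n" for j
    proof -
      have "?C V ^\<^sub>m k = ?C (V ^\<^sub>m k)" using of_real_hom.mat_hom_pow[OF V] by metis
      hence "norm (complex_of_real ((V ^\<^sub>m k) $$ (i, j))) \<le> c"
        using c[of k] that i V unfolding norm_bound_def by (auto simp: norm_of_real)
      thus ?thesis by simp
    qed
    have "q ^ k * x $ i \<le> (V ^\<^sub>m k *\<^sub>v x) $ i"
      using pow_mat_nonneg_and_subinvariant(1)[OF V V0 x _ subV i(1)] q by simp
    also have "\<dots> = (\<Sum>j<n. (V ^\<^sub>m k) $$ (i, j) * x $ j)"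
      using index_mult_mat_vec_sum[of "V ^\<^sub>m k" n n x i] V x i by simp
    also have "\<dots> \<le> (\<Sum>j<n. c * x $ j)"
      using entry x0 by (intro sum_mono mult_right_mono) auto
    finally show ?thesis by (simp add: sum_distrib_left)
  qed
  \<comment> \<open>The bound just shown does not depend on \<open>k\<close>, but
    \<open>x $ i > 0\<close> and \<open>q > 1\<close> make its left side unbounded.\<close>
  moreover obtain k where "c * (\<Sum>j<n. x $ j) / x $ i < q ^ k"
    using real_arch_pow[OF q] by blast
  ultimately show False using xi by (metis divide_less_eq not_le)
qed

text \<open>With \<open>r\<close> the first spectral radius, \<open>r B1 + C1\<close> equals
  \<open>B1 + C1\<close> minus \<open>(1 - r) B1\<close>. The hypotheses compare exactly these two
  terms, and \<open>r \<le> 1\<close> keeps the weight \<open>1 - r\<close> nonnegative.\<close>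

lemma spectral_radius_companion_mono:
  fixes n :: nat and B1 C1 B2 C2 :: "real mat"
  defines "W1 \<equiv> four_block_mat B1 C1 (1\<^sub>m n) (0\<^sub>m n n)"
    and "W2 \<equiv> four_block_mat B2 C2 (1\<^sub>m n) (0\<^sub>m n n)"
  assumes n: "n > 0"
    and cm: "B1 \<in> carrier_mat n n" "C1 \<in> carrier_mat n n"
      "B2 \<in> carrier_mat n n" "C2 \<in> carrier_mat n n"
    and nn: "0\<^sub>m n n \<le> B1" "0\<^sub>m n n \<le> C1" "0\<^sub>m n n \<le> B2" "0\<^sub>m n n \<le> C2"
    and le: "B2 \<le> B1" "B1 + C1 \<le> B2 + C2"
    and r1: "real_spectral_radius W1 \<le> 1"
  shows "real_spectral_radius W1 \<le> real_spectral_radius W2"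
proof -
  let ?C = "map_mat complex_of_real"
  have W: "?C W1 \<in> carrier_mat (n + n) (n + n)" "W2 \<in> carrier_mat (n + n) (n + n)"
    using cm by (auto simp: W1_def W2_def)
  define r where "r = real_spectral_radius W1"
  obtain l where l: "l \<in> spectrum (?C W1)" "r = norm l"
    using spectral_radius_mem_max(1)[OF W(1)] n unfolding r_def real_spectral_radius_def by auto
  obtain v where v: "v \<in> carrier_vec (n + n)" "v \<noteq> 0\<^sub>v (n + n)" "?C W1 *\<^sub>v v = l \<cdot>\<^sub>v v"
    using l(1) W(1) unfolding spectrum_def eigenvalue_def eigenvector_def by auto
  define y u where "y = vec_first v n" and "u = vec_last v n"
  have yu: "y \<in> carrier_vec n" "u \<in> carrier_vec n" "v = y @\<^sub>v u"
    using vec_first_last_append[OF v(1)] by (simp_all add: y_def u_def)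
  have CW1: "?C W1 = four_block_mat (?C B1) (?C C1) (1\<^sub>m n) (0\<^sub>m n n)"
    using cm by (intro eq_matI) (auto simp: W1_def)
  have smult_append: "l \<cdot>\<^sub>v (y @\<^sub>v u) = l \<cdot>\<^sub>v y @\<^sub>v l \<cdot>\<^sub>v u"
    using yu by (intro eq_vecI) auto
  have "(?C B1 *\<^sub>v y + ?C C1 *\<^sub>v u) @\<^sub>v (1\<^sub>m n *\<^sub>v y + 0\<^sub>m n n *\<^sub>v u) = l \<cdot>\<^sub>v y @\<^sub>v l \<cdot>\<^sub>v u"
    using v(3) four_block_mat_mult_vec[of "?C B1" n n "?C C1" n "1\<^sub>m n" n "0\<^sub>m n n" y u] cm yu
    unfolding CW1 yu(3) smult_append by simp
  hence top: "?C B1 *\<^sub>v y + ?C C1 *\<^sub>v u = l \<cdot>\<^sub>v y" and "1\<^sub>m n *\<^sub>v y + 0\<^sub>m n n *\<^sub>v u = l \<cdot>\<^sub>v u"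
    using append_vec_eq[of "?C B1 *\<^sub>v y + ?C C1 *\<^sub>v u" n "l \<cdot>\<^sub>v y"] cm yu by auto
  \<comment> \<open>The lower block row \<open>(I 0)\<close> ties \<open>y\<close> to
    \<open>u\<close>, so the eigenvector is determined by \<open>u\<close> and \<open>u\<close>
    cannot vanish.\<close>
  hence y: "y = l \<cdot>\<^sub>v u" using yu by (simp add: zero_mat_mult_vec)
  have une: "u \<noteq> 0\<^sub>v n"
  proof
    assume "u = 0\<^sub>v n"
    hence "v = 0\<^sub>v (n + n)" using yu y by (intro eq_vecI) auto
    thus False using v by simp
  qed
  define a where "a = vec n (\<lambda>i. norm (u $ i))"
  have a: "a \<in> carrier_vec n" by (simp add: a_def)
  \<comment> \<open>This is the upper half of \<open>r x \<le> W2 x\<close> for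
    \<open>x = (r a, a)\<close>. The left side is the modulus of \<open>l * (l * u $ i)\<close>,
    obtained by substituting \<open>y = l u\<close> into the upper block row.\<close>
  have step: "r * (r * a $ i) \<le> (B2 *\<^sub>v (r \<cdot>\<^sub>v a) + C2 *\<^sub>v a) $ i" if i: "i < n" for i
  proof -
    have "l * (l * u $ i) = (\<Sum>j<n. ?C B1 $$ (i, j) * y $ j) + (\<Sum>j<n. ?C C1 $$ (i, j) * u $ j)"
      using arg_cong[OF top, of "\<lambda>w. w $ i"] i yu cm y
        index_mult_mat_vec_sum[of "?C B1" n n y i] index_mult_mat_vec_sum[of "?C C1" n n u i] by simp
    also have "\<dots> = (\<Sum>j<n. (l * of_real (B1 $$ (i, j)) + of_real (C1 $$ (i, j))) * u $ j)"
      unfolding sum.distrib[symmetric] using i cm yu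
      by (intro sum.cong) (auto simp: y algebra_simps)
    finally have eq: "l * (l * u $ i) = \<dots>" .
    have "r * (r * a $ i) = norm (l * (l * u $ i))" using i by (simp add: l(2) a_def norm_mult)
    also have "\<dots> \<le> (\<Sum>j<n. (r * B1 $$ (i, j) + C1 $$ (i, j)) * a $ j)"
      unfolding eq
    proof (rule sum_norm_le)
      fix j assume "j \<in> {..<n}"
      hence j: "j < n" by simp
      \<comment> \<open>Nonnegative entries equal their moduli, so the triangle inequality replaces
        \<open>l\<close> by \<open>r\<close> and leaves the real coefficients unchanged.\<close>
      have "0 \<le> B1 $$ (i, j)" "0 \<le> C1 $$ (i, j)" using nn i j cm by (auto simp: less_eq_mat_def)
      hence "norm (l * of_real (B1 $$ (i, j)) + of_real (C1 $$ (i, j))) \<le> r * B1 $$ (i, j) + C1 $$ (i, j)"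
        by (intro norm_triangle_le) (simp add: norm_mult l(2))
      thus "norm ((l * of_real (B1 $$ (i, j)) + of_real (C1 $$ (i, j))) * u $ j)
          \<le> (r * B1 $$ (i, j) + C1 $$ (i, j)) * a $ j"
        using j by (auto simp: norm_mult a_def intro: mult_right_mono)
    qed
    also have "\<dots> \<le> (\<Sum>j<n. (r * B2 $$ (i, j) + C2 $$ (i, j)) * a $ j)"
    proof (intro sum_mono mult_right_mono)
      fix j assume "j \<in> {..<n}"
      hence j: "j < n" by simp
      have "B2 $$ (i, j) \<le> B1 $$ (i, j)"
        and s: "B1 $$ (i, j) + C1 $$ (i, j) \<le> B2 $$ (i, j) + C2 $$ (i, j)"
        using le i j cm by (auto simp: less_eq_mat_def)
      hence "(1 - r) * B2 $$ (i, j) \<le> (1 - r) * B1 $$ (i, j)"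
        using r1 by (intro mult_left_mono) (auto simp: r_def)
      with s show "r * B1 $$ (i, j) + C1 $$ (i, j) \<le> r * B2 $$ (i, j) + C2 $$ (i, j)"
        by (simp add: algebra_simps)
      show "0 \<le> a $ j" using j by (simp add: a_def)
    qed
    also have "\<dots> = (B2 *\<^sub>v (r \<cdot>\<^sub>v a) + C2 *\<^sub>v a) $ i"
      using i cm a index_mult_mat_vec_sum[of B2 n n "r \<cdot>\<^sub>v a" i] index_mult_mat_vec_sum[of C2 n n a i]
      by (simp add: distrib_right distrib_left sum.distrib ac_simps)
    finally show ?thesis .
  qed
  let ?x = "r \<cdot>\<^sub>v a @\<^sub>v a"
  \<comment> \<open>The lower half of \<open>W2 x\<close> is \<open>r a\<close>, so subinvariance
    holds there with equality.\<close>
  have W2x: "W2 *\<^sub>v ?x = (B2 *\<^sub>v (r \<cdot>\<^sub>v a) + C2 *\<^sub>v a) @\<^sub>v (r \<cdot>\<^sub>v a)"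
    using four_block_mat_mult_vec[of B2 n n C2 n "1\<^sub>m n" n "0\<^sub>m n n" "r \<cdot>\<^sub>v a" a] cm a
    by (simp add: W2_def zero_mat_mult_vec)
  have "r \<le> real_spectral_radius W2"
  proof (rule real_spectral_radius_ge_subinvariant[OF W(2), of ?x])
    show "0 \<le> W2 $$ (i, j)" if "i < n + n" "j < n + n" for i j
      using that nn cm by (auto simp: W2_def less_eq_mat_def)
    show "?x \<in> carrier_vec (n + n)" using a by simp
    show "0 \<le> ?x $ i" if "i < n + n" for i using that l(2) by (auto simp: a_def append_vec_def)
    \<comment> \<open>The lower half \<open>a\<close> of the vector witnesses this, so the argument
      also covers \<open>r = 0\<close>.\<close>
    show "?x \<noteq> 0\<^sub>v (n + n)"
    proof
      assume x0: "?x = 0\<^sub>v (n + n)"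
      have "u = 0\<^sub>v n"
      proof (rule eq_vecI)
        fix i assume "i < dim_vec (0\<^sub>v n :: complex vec)"
        thus "u $ i = 0\<^sub>v n $ i"
          using arg_cong[OF x0, of "\<lambda>w. w $ (n + i)"] by (simp add: a_def)
      qed (use yu in simp)
      thus False using une by simp
    qed
    show "r * ?x $ i \<le> (W2 *\<^sub>v ?x) $ i" if "i < n + n" for i
      using that step[of i] cm a unfolding W2x by (cases "i < n") simp_all
  qed
  thus ?thesis by (simp add: r_def)
qed

theorem theorem3p17:
  fixes n :: nat and A1 P1 R1 S1 A2 P2 R2 S2 :: "real mat"
  assumes "n \<ge> 1"
    and "A1 \<in> carrier_mat n n" and "invertible_mat A1" and "A1\<^sup>T = A1"
    and "A2 \<in> carrier_mat n n" and "invertible_mat A2" and "A2\<^sup>T = A2"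
    and "convergent_double_weak_splitting_II n A1 P1 R1 S1"
    and "convergent_double_weak_splitting_I n A2 P2 R2 S2"
    and "mat_inv P2 * R2 \<le> (R1 * mat_inv P1)\<^sup>T"
    and "mat_inv P2 * A2 \<le> (mat_inv P1)\<^sup>T * A1"
  shows "real_spectral_radius (block_II n P1 R1 S1) \<le> real_spectral_radius (block_I n P2 R2 S2)
    \<and> real_spectral_radius (block_I n P2 R2 S2) < 1"
proof
  show lt: "real_spectral_radius (block_I n P2 R2 S2) < 1"
    using assms(9) unfolding convergent_double_weak_splitting_I_def by simp
  have c1: "P1 \<in> carrier_mat n n" "R1 \<in> carrier_mat n n" "S1 \<in> carrier_mat n n"
    and i1: "invertible_mat P1" and A1: "A1 = P1 - R1 + S1"
    and nn1: "0\<^sub>m n n \<le> R1 * mat_inv P1" "0\<^sub>m n n \<le> - (S1 * mat_inv P1)"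
    and r1: "real_spectral_radius (block_II n P1 R1 S1) < 1"
    using assms(8) unfolding convergent_double_weak_splitting_II_def double_weak_splitting_II_def
      splitting_base_def by auto
  have c2: "P2 \<in> carrier_mat n n" "R2 \<in> carrier_mat n n" "S2 \<in> carrier_mat n n"
    and i2: "invertible_mat P2" and A2: "A2 = P2 - R2 + S2"
    and nn2: "0\<^sub>m n n \<le> mat_inv P2 * R2" "0\<^sub>m n n \<le> - (mat_inv P2 * S2)"
    using assms(9) unfolding convergent_double_weak_splitting_I_def double_weak_splitting_I_def
      splitting_base_def by auto
  note inv1 = mat_inv_inverse[OF c1(1) i1] and inv2 = mat_inv_inverse[OF c2(1) i2]
  let ?Q1 = "mat_inv P1" and ?Q2 = "mat_inv P2"
  \<comment> \<open>Symmetry of \<open>A1\<close> enters here: it turns the product into the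
    transpose of \<open>A1 * ?Q1\<close>, in which the splitting expands into the right-hand
    products of type II.\<close>
  have "?Q1\<^sup>T * A1 = (A1 * ?Q1)\<^sup>T"
    using transpose_mult[OF assms(2) inv1(3)] assms(4) by simp
  also have "A1 * ?Q1 = 1\<^sub>m n - R1 * ?Q1 + S1 * ?Q1"
    unfolding A1 using add_mult_distrib_mat[OF minus_carrier_mat[OF c1(2)] c1(3) inv1(3), of P1]
      minus_mult_distrib_mat[OF c1(1,2) inv1(3)] inv1(1) by simp
  finally have QA1: "?Q1\<^sup>T * A1 = (1\<^sub>m n - R1 * ?Q1 + S1 * ?Q1)\<^sup>T" .
  have QA2: "?Q2 * A2 = 1\<^sub>m n - ?Q2 * R2 + ?Q2 * S2"
    unfolding A2 using mult_add_distrib_mat[OF inv2(3) minus_carrier_mat[OF c2(2)] c2(3), of P2]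
      mult_minus_distrib_mat[OF inv2(3) c2(1,2)] inv2(2) by simp
  \<comment> \<open>The second blocks of the companion matrices are \<open>- D1\<^sup>T\<close> and
    \<open>- D2\<close>; the first matrix also uses \<open>B1\<^sup>T\<close>.\<close>
  define B1 D1 B2 D2 where "B1 = R1 * ?Q1" and "D1 = S1 * ?Q1" and "B2 = ?Q2 * R2" and "D2 = ?Q2 * S2"
  note defs = B1_def[symmetric] D1_def[symmetric] B2_def[symmetric] D2_def[symmetric]
  have cm: "B1 \<in> carrier_mat n n" "D1 \<in> carrier_mat n n" "B2 \<in> carrier_mat n n" "D2 \<in> carrier_mat n n"
    using c1 c2 inv1(3) inv2(3) by (auto simp: B1_def D1_def B2_def D2_def)
  have "B1\<^sup>T $$ (i, j) + - D1\<^sup>T $$ (i, j) \<le> B2 $$ (i, j) + - D2 $$ (i, j)" if "i < n" "j < n" for i j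
  proof -
    \<comment> \<open>The identity is its own transpose and cancels; the remaining signs reverse the
      inequality into the required comparison of block sums.\<close>
    have "(1\<^sub>m n - B2 + D2) $$ (i, j) \<le> (1\<^sub>m n - B1 + D1)\<^sup>T $$ (i, j)"
      using assms(11) that cm unfolding QA1 QA2 defs less_eq_mat_def by simp
    thus ?thesis using that cm by (simp split: if_splits)
  qed
  hence "B1\<^sup>T + - D1\<^sup>T \<le> B2 + - D2"
    using cm by (simp add: less_eq_mat_def)
  thus "real_spectral_radius (block_II n P1 R1 S1) \<le> real_spectral_radius (block_I n P2 R2 S2)"
    using spectral_radius_companion_mono[of n "B1\<^sup>T" "- D1\<^sup>T" B2 "- D2"] assms(1,10) nn1 nn2 r1 cm
    unfolding block_I_def block_II_def defs by (auto simp: less_eq_mat_def)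
qed

end
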